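(* Suppose $s \in [0,1]$. Then there exist real sequences $\{a_n(s)\}_n$ and $\{b_n(s)\}_n$, with $b_n(s)>0$ for all but finitely many $n$, such that \[ \lim_{n \to \infty} \sup_{x \in \mathbb{R}} \left| \frac{1}{P_n^{h_s}(1)} \sum_{k \le a_n(s) + x\, b_n(s)} A_{n,k}(s) - \frac{1}{\sqrt{2\pi}} \int_{-\infty}^{x} e^{-t^2/2}\, dt \right| = 0 . \]
   Context: For $s\in\mathbb{R}$ define polynomials $P_n^{h_s}(x)$ recursively by $P_0^{h_s}(x):=1$ and, for $n\ge 1$, $P_n^{h_s}(x) := \frac{x}{n^s}\sum_{k=0}^{n-1} P_k^{h_s}(x)$. Write $P_n^{h_s}(x)=\sum_{k=0}^n A_{n,k}(s)\,x^k$; the numbers $A_{n,k}(s)$ are its coefficients (so $A_{n,k}(0)=\binom{n-1}{k-1}$ and $A_{n,k}(1)=\frac{1}{n!}\left[{n \atop k}\right]$, unsigned Stirling numbers of the first kind). *)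

theory Defs
  imports "HOL-Analysis.Analysis" "HOL-Computational_Algebra.Polynomial"
begin

fun Ph :: "real \<Rightarrow> nat \<Rightarrow> real poly" where
  "Ph s 0 = 1"
| "Ph s (Suc n) = smult (1 / real (Suc n) powr s) ([:0, 1:] * (\<Sum>k\<in>{0..n}. Ph s k))"

definition Acoef :: "nat \<Rightarrow> nat \<Rightarrow> real \<Rightarrow> real" where
  "Acoef n k s = coeff (Ph s n) k"

end

theory Submission
  imports Defs "HOL-Probability.Probability"
begin

text \<open>
  The partial sums of the recursion telescope to a product, so that the normalised polynomial
  \<open>P\<^sub>n(x) / P\<^sub>n(1)\<close> equals \<open>\<Prod>k<n. (1 - p\<^sub>k + p\<^sub>k x)\<close> with \<open>p\<^sub>0 = 1\<close> and \<open>p\<^sub>k = 1 / (1 + k\<^sup>s)\<close>. It is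
  the probability generating function of a sum of independent Bernoulli variables. For \<open>0 \<le> s \<le> 1\<close>
  the variance of this sum is at least a quarter of a harmonic number, hence unbounded. Comparing
  the factors of the characteristic function with those of the Gaussian one yields convergence in
  distribution by Levy's continuity theorem, and since the limiting distribution function is
  continuous, the convergence is uniform (Polya).
\<close>

section \<open>Uniform convergence of distribution functions\<close>

text \<open>Intermediate value theorem between the limits 0 and 1 at the two ends; these two values
  themselves need not be attained. Supplies the grid points for the uniform estimate.\<close>

lemma ex_cdf_eq:
  assumes "real_distribution M" and cont: "continuous_on UNIV (cdf M)" and y: "0 < y" "y < 1"
  shows "\<exists>x. cdf M x = y"
proof -
  interpret real_distribution M by fact
  obtain a where a: "cdf M a < y"
    using order_tendstoD(2)[OF cdf_lim_at_bot y(1)] eventually_happens'[OF trivial_limit_at_bot_linorder] by blast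
  obtain b where b: "y < cdf M b"
    using order_tendstoD(1)[OF cdf_lim_at_top_prob y(2)] eventually_happens'[OF trivial_limit_at_top_linorder] by blast
  have "a \<le> b"
    using a b cdf_nondecreasing[of b a] by linarith
  then show ?thesis
    using IVT'[of "cdf M" a y b] a b cont continuous_on_subset[OF cont subset_UNIV] by auto
qed

text \<open>
  A grid of points at which the limiting distribution function takes the values \<open>i / N\<close> controls
  all other points by monotonicity.
\<close>

theorem Polya_uniform_cdf_convergence:
  assumes distr: "\<And>n. real_distribution (M n)" "real_distribution M'"
    and cont: "continuous_on UNIV (cdf M')"
    and conv: "weak_conv_m M M'"
  shows "(\<lambda>n. SUP x. \<bar>cdf (M n) x - cdf M' x\<bar>) \<longlonglongrightarrow> 0"
proof -
  interpret M': real_distribution M' by fact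
  interpret Mn: real_distribution "M n" for n by (rule distr)
  \<comment> \<open>Weak convergence gives convergence at the continuity points of the limit, here
    at every point.\<close>
  have lim: "(\<lambda>n. cdf (M n) x) \<longlonglongrightarrow> cdf M' x" for x
    using conv cont unfolding weak_conv_m_def weak_conv_def
    by (auto simp: continuous_on_eq_continuous_at)
  have bound1: "\<bar>cdf (M n) x - cdf M' x\<bar> \<le> 1" for n x
    using Mn.cdf_nonneg[of n x] M'.cdf_nonneg[of x] Mn.cdf_bounded_prob[of n x] M'.cdf_bounded_prob[of x]
    by linarith
  have nonneg: "0 \<le> (SUP x. \<bar>cdf (M n) x - cdf M' x\<bar>)" for n
    by (rule cSUP_upper2[where x = 0]) (auto intro!: bdd_aboveI[where M = 1] bound1)
  show ?thesis
  proof (rule LIMSEQ_I)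
    fix e :: real assume "0 < e"
    \<comment> \<open>With this choice the final error \<open>3 / real N\<close> stays below
      \<open>e\<close>.\<close>
    obtain N :: nat where N: "4 / e < real N" using reals_Archimedean2 by blast
    have "0 < 4 / e" using \<open>0 < e\<close> by simp
    with N have N0: "0 < real N" by linarith
    have Ne: "4 / real N < e" using N N0 \<open>0 < e\<close> by (simp add: field_simps)
    have "\<exists>x. \<forall>i\<in>{1..<N}. cdf M' (x i) = real i / real N"
      by (intro bchoice[rule_format] ex_cdf_eq distr cont) auto
    then obtain x where x: "\<And>i. 1 \<le> i \<Longrightarrow> i < N \<Longrightarrow> cdf M' (x i) = real i / real N"
      by (metis atLeastLessThan_iff)
    \<comment> \<open>There are finitely many grid points, so one threshold serves them all.\<close>
    have "\<forall>\<^sub>F n in sequentially. \<forall>i\<in>{1..<N}. \<bar>cdf (M n) (x i) - cdf M' (x i)\<bar> < 1 / real N"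
    proof (rule eventually_ball_finite, simp, intro ballI)
      fix i
      show "\<forall>\<^sub>F n in sequentially. \<bar>cdf (M n) (x i) - cdf M' (x i)\<bar> < 1 / real N"
        using tendstoD[OF lim[of "x i"], of "1 / real N"] N0 by (simp add: dist_real_def)
    qed
    then obtain n0 where n0: "\<And>n i. n \<ge> n0 \<Longrightarrow> 1 \<le> i \<Longrightarrow> i < N \<Longrightarrow>
        \<bar>cdf (M n) (x i) - cdf M' (x i)\<bar> < 1 / real N"
      unfolding eventually_sequentially by (auto simp: Ball_def)
    have main: "\<bar>cdf (M n) y - cdf M' y\<bar> \<le> 3 / real N" if n: "n \<ge> n0" for n y
    proof -
      define i where "i = nat \<lfloor>real N * cdf M' y\<rfloor>"
      have nn: "0 \<le> real N * cdf M' y" using M'.cdf_nonneg[of y] N0 by simp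
      have i1: "real i \<le> real N * cdf M' y" and i2: "real N * cdf M' y < real i + 1"
        unfolding i_def using nn by linarith+
      have lo: "real i / real N \<le> cdf M' y" and hi: "cdf M' y < (real i + 1) / real N"
        using i1 i2 N0 by (simp_all add: field_simps)
      have low: "cdf M' y - 3 / real N \<le> cdf (M n) y"
      proof (cases "2 \<le> i")
        case True
        have "i \<le> N"
          using i1 mult_left_mono[OF M'.cdf_bounded_prob[of y], of "real N"] N0 by linarith
        \<comment> \<open>The index is \<open>i - 1\<close> rather than \<open>i\<close>: this grid
          point exists even if \<open>cdf M' y\<close> is 1, and its strictly smaller value forces
          it not to exceed \<open>y\<close>. Two grid steps and one convergence error give
          \<open>3 / real N\<close>.\<close>
        have j: "1 \<le> i - 1" "i - 1 < N" using True \<open>i \<le> N\<close> by auto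
        have eq: "cdf M' (x (i - 1)) = (real i - 1) / real N"
          using x[OF j] True by (simp add: of_nat_diff)
        have "cdf M' (x (i - 1)) < cdf M' y"
        proof -
          have "(real i - 1) / real N < real i / real N"
            using N0 by (intro divide_strict_right_mono) auto
          with lo eq show ?thesis by linarith
        qed
        then have "x (i - 1) \<le> y" using M'.cdf_nondecreasing[of y "x (i - 1)"] by linarith
        then have "cdf (M n) (x (i - 1)) \<le> cdf (M n) y" by (rule Mn.cdf_nondecreasing)
        with n0[OF n j] eq hi show ?thesis
          by (simp add: diff_divide_distrib add_divide_distrib)
      next
        case False
        then have "(real i + 1) / real N \<le> 3 / real N" by (intro divide_right_mono) auto
        with hi Mn.cdf_nonneg[of n y] show ?thesis by linarith
      qed
      have high: "cdf (M n) y \<le> cdf M' y + 3 / real N"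
      proof (cases "i + 1 < N")
        case True
        have j: "1 \<le> i + 1" by simp
        have eq: "cdf M' (x (i + 1)) = (real i + 1) / real N"
          using x[OF j True] by simp
        then have "y \<le> x (i + 1)"
          using hi M'.cdf_nondecreasing[of "x (i + 1)" y] by linarith
        then have "cdf (M n) y \<le> cdf (M n) (x (i + 1))" by (rule Mn.cdf_nondecreasing)
        with n0[OF n j True] eq lo show ?thesis
          by (simp add: add_divide_distrib)
      next
        case False
        \<comment> \<open>No grid point is available above, but \<open>cdf M' y\<close> is within
          \<open>1 / real N\<close> of 1, so the trivial bound 1 suffices.\<close>
        then have "(real N - 1) / real N \<le> real i / real N" using N0 by (intro divide_right_mono) auto
        then have "1 - 1 / real N \<le> cdf M' y" using lo N0 by (simp add: diff_divide_distrib)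
        moreover have "1 / real N \<le> 3 / real N" using N0 by (intro divide_right_mono) auto
        ultimately show ?thesis using Mn.cdf_bounded_prob[of n y] by linarith
      qed
      show ?thesis using low high by linarith
    qed
    have "norm ((SUP x. \<bar>cdf (M n) x - cdf M' x\<bar>) - 0) < e" if "n \<ge> n0" for n
    proof -
      have "(SUP x. \<bar>cdf (M n) x - cdf M' x\<bar>) \<le> 3 / real N"
        by (rule cSUP_least) (auto intro: main[OF that])
      also have "\<dots> \<le> 4 / real N" using N0 by (intro divide_right_mono) auto
      finally show ?thesis using nonneg[of n] Ne by simp
    qed
    then show "\<exists>no. \<forall>n\<ge>no. norm ((SUP x. \<bar>cdf (M n) x - cdf M' x\<bar>) - 0) < e" by blast
  qed
qed

section \<open>The standard normal distribution function\<close>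

lemma cdf_std_normal_distribution:
  "cdf std_normal_distribution x = 1 / sqrt (2 * pi) * (LBINT t:{..x}. exp (- t\<^sup>2 / 2))"
proof -
  have "cdf std_normal_distribution x = (LINT t|std_normal_distribution. indicator {..x} t)"
    by (simp add: cdf_def)
  also have "\<dots> = (LBINT t. std_normal_density t *\<^sub>R indicator {..x} t)"
    by (intro integral_density) auto
  also have "\<dots> = (LBINT t. 1 / sqrt (2 * pi) * (indicator {..x} t *\<^sub>R exp (- t\<^sup>2 / 2)))"
    by (intro Bochner_Integration.integral_cong) (auto simp: std_normal_density_def)
  also have "\<dots> = 1 / sqrt (2 * pi) * (LBINT t:{..x}. exp (- t\<^sup>2 / 2))"
    unfolding set_lebesgue_integral_def by (rule integral_mult_right_zero)
  finally show ?thesis .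
qed

lemma continuous_on_cdf_std_normal_distribution:
  "continuous_on UNIV (cdf std_normal_distribution)"
proof -
  interpret real_distribution std_normal_distribution by (rule real_dist_normal_dist)
  have "emeasure std_normal_distribution {x} = 0" for x
    by (subst emeasure_density) (auto simp: nn_integral_indicator_singleton)
  then show ?thesis
    by (auto simp: continuous_on_eq_continuous_at isCont_cdf measure_def)
qed

section \<open>Distributions given by generating polynomials\<close>

text \<open>The law on the naturals with probability generating function \<open>q\<close>. This
  reading presupposes nonnegative coefficients that sum to 1.\<close>

definition poly_pmf :: "real poly \<Rightarrow> nat pmf" where
  "poly_pmf q = embed_pmf (coeff q)"

lemma pmf_poly_pmf:
  assumes "\<And>k. 0 \<le> coeff q k" and "poly q 1 = 1"
  shows "pmf (poly_pmf q) k = coeff q k"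
  unfolding poly_pmf_def
proof (rule pmf_embed_pmf)
  have "(\<integral>\<^sup>+ k. ennreal (coeff q k) \<partial>count_space UNIV) = (\<Sum>k\<le>degree q. ennreal (coeff q k))"
    by (intro nn_integral_count_space') (auto simp: coeff_eq_0)
  also have "\<dots> = 1"
    using assms by (simp add: sum_ennreal poly_altdef)
  finally show "(\<integral>\<^sup>+ k. ennreal (coeff q k) \<partial>count_space UNIV) = 1" .
qed (use assms in auto)

lemma cdf_distr_poly_pmf:
  assumes "\<And>k. 0 \<le> coeff q k" and "poly q 1 = 1" and "degree q \<le> n" and "0 < b"
  shows "cdf (distr (poly_pmf q) borel (\<lambda>k. (real k - a) / b)) x
    = (\<Sum>k | k \<le> n \<and> real k \<le> a + x * b. coeff q k)"
proof -
  let ?S = "{k. real k \<le> a + x * b}"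
  have "cdf (distr (poly_pmf q) borel (\<lambda>k. (real k - a) / b)) x = measure (poly_pmf q) ?S"
    using \<open>0 < b\<close> by (simp add: cdf_def measure_distr vimage_def divide_le_eq diff_le_eq add.commute)
  \<comment> \<open>Passing to the support permits the cut \<open>k \<le> n\<close>, since
    coefficients beyond the degree vanish.\<close>
  also have "\<dots> = measure (poly_pmf q) (?S \<inter> set_pmf (poly_pmf q))"
    by (simp add: measure_Int_set_pmf)
  also have "?S \<inter> set_pmf (poly_pmf q) = {k. k \<le> n \<and> real k \<le> a + x * b} \<inter> set_pmf (poly_pmf q)"
    using assms(3) le_degree[of q] by (fastforce simp: set_pmf_eq pmf_poly_pmf[OF assms(1,2)])
  also have "measure (poly_pmf q) \<dots> = (\<Sum>k | k \<le> n \<and> real k \<le> a + x * b. coeff q k)"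
    by (simp add: measure_Int_set_pmf measure_measure_pmf_finite pmf_poly_pmf[OF assms(1,2)])
  finally show ?thesis .
qed

lemma map_poly_of_real_mult:
  "map_poly of_real (p * q) = map_poly of_real p * (map_poly of_real q :: 'a::{real_algebra_1,comm_semiring_1} poly)"
  by (intro poly_eqI) (simp add: coeff_map_poly coeff_mult)

lemma map_poly_of_real_prod:
  "map_poly of_real (\<Prod>k\<in>A. q k) = (\<Prod>k\<in>A. map_poly of_real (q k) :: 'a::{real_algebra_1,comm_semiring_1} poly)"
  by (induction A rule: infinite_finite_induct) (simp_all add: map_poly_of_real_mult)

text \<open>The expectation of \<open>z ^ k\<close> is the generating function at
  \<open>z = iexp (t / b)\<close>; centring by \<open>a\<close> contributes the phase.\<close>

lemma char_distr_poly_pmf: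
  assumes "\<And>k. 0 \<le> coeff q k" and "poly q 1 = 1"
  shows "char (distr (poly_pmf q) borel (\<lambda>k. (real k - a) / b)) t
    = iexp (- (t / b * a)) * poly (map_poly of_real q) (iexp (t / b))"
proof -
  have "char (distr (poly_pmf q) borel (\<lambda>k. (real k - a) / b)) t
      = (LINT k|poly_pmf q. iexp (t * ((real k - a) / b)))"
    unfolding char_def by (simp add: integral_distr)
  also have "\<dots> = (\<Sum>k\<le>degree q. coeff q k *\<^sub>R iexp (t * ((real k - a) / b)))"
    by (subst integral_measure_pmf[where A = "{..degree q}"])
       (auto simp: set_pmf_eq pmf_poly_pmf[OF assms] intro!: le_degree)
  also have "\<dots> = (\<Sum>k\<le>degree q. iexp (- (t / b * a)) * (of_real (coeff q k) * iexp (t / b) ^ k))"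
  proof (rule sum.cong)
    fix k
    have "iexp (t * ((real k - a) / b)) = iexp (- (t / b * a)) * iexp (t / b) ^ k"
      unfolding exp_of_nat_mult[symmetric] exp_add[symmetric]
      by (rule arg_cong[where f = exp]) (simp add: field_simps diff_divide_distrib)
    then show "coeff q k *\<^sub>R iexp (t * ((real k - a) / b)) =
        iexp (- (t / b * a)) * (of_real (coeff q k) * iexp (t / b) ^ k)"
      by (simp add: scaleR_conv_of_real)
  qed simp
  also have "\<dots> = iexp (- (t / b * a)) * poly (map_poly of_real q) (iexp (t / b))"
    by (simp add: poly_altdef degree_map_poly coeff_map_poly sum_distrib_left)
  finally show ?thesis .
qed

section \<open>Estimates for Bernoulli characteristic functions\<close>

text \<open>Squeeze:
  \<open>1 - y \<le> exp (- y) \<le> 1 / (1 + y) \<le> 1 - y + y^2\<close>.\<close>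

lemma abs_exp_minus_approx:
  fixes y :: real
  assumes "0 \<le> y"
  shows "\<bar>exp (- y) - (1 - y)\<bar> \<le> y\<^sup>2"
proof -
  have "exp (- y) \<le> 1 / (1 + y)"
    using assms exp_ge_add_one_self[of y] by (simp add: exp_minus inverse_eq_divide frac_le)
  also have "\<dots> \<le> 1 - y + y\<^sup>2"
    using assms by (simp add: field_simps power2_eq_square)
  finally show ?thesis
    using exp_ge_add_one_self[of "- y"] by simp
qed

text \<open>The characteristic function of a centred Bernoulli variable.\<close>

definition bernoulli_char :: "real \<Rightarrow> real \<Rightarrow> complex" where
  "bernoulli_char p u = iexp (- (u * p)) * (of_real (1 - p) + of_real p * iexp u)"

text \<open>The expectation over the two centred values \<open>- p\<close> and \<open>1 - p\<close>:
  for \<open>p\<close> in [0,1] a convex combination of points on the unit circle.\<close>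

lemma bernoulli_char_altdef:
  "bernoulli_char p u = of_real (1 - p) * iexp (- (u * p)) + of_real p * iexp (u * (1 - p))"
proof -
  have "iexp (- (u * p)) * iexp u = iexp (u * (1 - p))"
    unfolding exp_add[symmetric] by (rule arg_cong[where f = exp]) (simp add: algebra_simps)
  then show ?thesis
    unfolding bernoulli_char_def by (simp add: algebra_simps)
qed

lemma norm_bernoulli_char_le_1:
  assumes "0 \<le> p" "p \<le> 1"
  shows "norm (bernoulli_char p u) \<le> 1"
proof -
  have "norm (bernoulli_char p u) \<le> norm (of_real (1 - p) * iexp (- (u * p))) + norm (of_real p * iexp (u * (1 - p)))"
    unfolding bernoulli_char_altdef by (rule norm_triangle_ineq)
  also have "\<dots> = 1"
    using assms unfolding norm_mult norm_exp_i_times norm_of_real by simp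
  finally show ?thesis .
qed

lemma iexp_approx_quadratic:
  "norm (iexp x - (1 + \<i> * of_real x - of_real (x\<^sup>2 / 2))) \<le> \<bar>x\<bar> ^ 3 / 6"
  using iexp_approx1[of x 2]
  by (simp add: numeral_2_eq_2 numeral_3_eq_3 fact_numeral power_mult_distrib algebra_simps)

text \<open>Both terms are close to \<open>1 - u^2 * v / 2\<close>, with \<open>v\<close> the
  variance. The factor \<open>p * (1 - p)\<close> is kept in the error so that the errors of many
  variables add up to a multiple of the total variance.\<close>

lemma bernoulli_char_approx:
  assumes p: "0 \<le> p" "p \<le> 1"
  shows "norm (bernoulli_char p u - of_real (exp (- (u\<^sup>2 * (p * (1 - p)) / 2))))
    \<le> p * (1 - p) * (\<bar>u\<bar> ^ 3 + u ^ 4)"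
proof -
  define v where "v = p * (1 - p)"
  have v: "0 \<le> v" "v \<le> 1" using p by (auto simp: v_def mult_le_one)
  define R where "R x = iexp x - (1 + \<i> * of_real x - of_real (x\<^sup>2 / 2))" for x :: real
  have R: "norm (R x) \<le> \<bar>x\<bar> ^ 3 / 6" for x
    unfolding R_def by (rule iexp_approx_quadratic)
  have iexp: "iexp x = 1 + \<i> * of_real x - of_real (x\<^sup>2 / 2) + R x" for x
    by (simp add: R_def)
  \<comment> \<open>Centring cancels the first-order terms and the second-order ones combine to the
    variance, leaving only Taylor remainders.\<close>
  have "bernoulli_char p u - of_real (1 - u\<^sup>2 * v / 2)
      = of_real (1 - p) * R (- (u * p)) + of_real p * R (u * (1 - p))"
    unfolding bernoulli_char_altdef iexp v_def by (simp add: power2_eq_square field_simps)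
  then have "norm (bernoulli_char p u - of_real (1 - u\<^sup>2 * v / 2))
      \<le> (1 - p) * norm (R (- (u * p))) + p * norm (R (u * (1 - p)))"
    using norm_triangle_ineq[of "of_real (1 - p) * R (- (u * p))" "of_real p * R (u * (1 - p))"] p
    by (simp add: norm_mult del: of_real_diff)
  also have "\<dots> \<le> (1 - p) * (\<bar>- (u * p)\<bar> ^ 3 / 6) + p * (\<bar>u * (1 - p)\<bar> ^ 3 / 6)"
    using p by (intro add_mono mult_left_mono R) auto
  \<comment> \<open>The third absolute central moment is
    \<open>v * (p^2 + (1 - p)^2)\<close>.\<close>
  also have "\<dots> = v * \<bar>u\<bar> ^ 3 * ((p\<^sup>2 + (1 - p)\<^sup>2) / 6)"
  proof -
    have *: "(1 - p) * ((p * y) ^ 3 / 6) + p * (((1 - p) * y) ^ 3 / 6)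
        = p * (1 - p) * y ^ 3 * ((p\<^sup>2 + (1 - p)\<^sup>2) / 6)" for y :: real
      by (simp add: power2_eq_square power3_eq_cube field_simps)
    have abs: "\<bar>- (u * p)\<bar> = p * \<bar>u\<bar>" "\<bar>u * (1 - p)\<bar> = (1 - p) * \<bar>u\<bar>"
      using p by (simp_all add: abs_mult)
    show ?thesis
      unfolding abs v_def by (rule *)
  qed
  also have "\<dots> \<le> v * \<bar>u\<bar> ^ 3 * 1"
  proof (intro mult_left_mono)
    have "p\<^sup>2 \<le> 1" "(1 - p)\<^sup>2 \<le> 1" using p by (auto simp: power_le_one)
    then show "(p\<^sup>2 + (1 - p)\<^sup>2) / 6 \<le> 1" by simp
  qed (use v in auto)
  finally have 1: "norm (bernoulli_char p u - of_real (1 - u\<^sup>2 * v / 2)) \<le> v * \<bar>u\<bar> ^ 3" by simp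
  have "norm (of_real (1 - u\<^sup>2 * v / 2) - of_real (exp (- (u\<^sup>2 * v / 2))) :: complex)
      = \<bar>exp (- (u\<^sup>2 * v / 2)) - (1 - u\<^sup>2 * v / 2)\<bar>"
    unfolding of_real_diff[symmetric] norm_of_real by (rule abs_minus_commute)
  also have "\<dots> \<le> (u\<^sup>2 * v / 2)\<^sup>2"
    using v by (intro abs_exp_minus_approx) auto
  also have "\<dots> = u ^ 4 * v * (v / 4)"
    by (simp add: power2_eq_square power4_eq_xxxx)
  also have "\<dots> \<le> u ^ 4 * v * 1"
    using v by (intro mult_left_mono) auto
  finally have 2: "norm (of_real (1 - u\<^sup>2 * v / 2) - of_real (exp (- (u\<^sup>2 * v / 2))) :: complex) \<le> v * u ^ 4"
    by (simp add: mult.commute)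
  show ?thesis
    using norm_diff_triangle_le[OF 1 2] by (simp only: v_def distrib_left)
qed

section \<open>Central limit theorem for Bernoulli sums\<close>

text \<open>Independence is encoded by multiplying the generating functions
  \<open>1 - p k + p k * x\<close>; no joint probability space is constructed.\<close>

definition bernoulli_sum_poly :: "(nat \<Rightarrow> real) \<Rightarrow> nat \<Rightarrow> real poly" where
  "bernoulli_sum_poly p n = (\<Prod>k<n. [:1 - p k, p k:])"

lemma coeff_bernoulli_sum_poly_nonneg:
  assumes "\<And>k. 0 \<le> p k" "\<And>k. p k \<le> 1"
  shows "0 \<le> coeff (bernoulli_sum_poly p n) j"
proof (induction n arbitrary: j)
  case (Suc n)
  have "0 \<le> coeff [:1 - p n, p n:] i" for i
    using assms[of n] by (auto simp: coeff_pCons split: nat.split)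
  with Suc show ?case
    unfolding bernoulli_sum_poly_def prod.lessThan_Suc coeff_mult
    by (intro sum_nonneg mult_nonneg_nonneg)
qed (auto simp: bernoulli_sum_poly_def coeff_1)

lemma poly_bernoulli_sum_poly_1: "poly (bernoulli_sum_poly p n) 1 = 1"
  by (simp add: bernoulli_sum_poly_def poly_prod)

lemma degree_bernoulli_sum_poly_le: "degree (bernoulli_sum_poly p n) \<le> n"
proof -
  have "degree (bernoulli_sum_poly p n) \<le> (\<Sum>k<n. degree [:1 - p k, p k:])"
    unfolding bernoulli_sum_poly_def by (rule degree_prod_sum_le[unfolded comp_def]) simp
  also have "\<dots> \<le> (\<Sum>k<n. 1)" by (intro sum_mono) auto
  finally show ?thesis by simp
qed

text \<open>At \<open>u = t / sqrt (V n)\<close> the total error is at most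
  \<open>V n * (\<bar>u\<bar> ^ 3 + u ^ 4)\<close>, which tends to 0, so divergence of the variance
  suffices.\<close>

theorem bernoulli_sum_central_limit:
  fixes p :: "nat \<Rightarrow> real"
  assumes p: "\<And>k. 0 \<le> p k" "\<And>k. p k \<le> 1"
  defines "\<mu> n \<equiv> \<Sum>k<n. p k" and "V n \<equiv> \<Sum>k<n. p k * (1 - p k)"
  assumes V: "filterlim V at_top sequentially"
  shows "weak_conv_m
    (\<lambda>n. distr (poly_pmf (bernoulli_sum_poly p n)) borel (\<lambda>k. (real k - \<mu> n) / sqrt (V n)))
    std_normal_distribution"
    (is "weak_conv_m ?M _")
proof (rule levy_continuity)
  fix t :: real
  let ?u = "\<lambda>n. t / sqrt (V n)"
  have char_eq: "char (?M n) t = (\<Prod>k<n. bernoulli_char (p k) (?u n))" for n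
  proof -
    have "char (?M n) t = iexp (- (?u n * \<mu> n)) * poly (map_poly of_real (bernoulli_sum_poly p n)) (iexp (?u n))"
      by (intro char_distr_poly_pmf coeff_bernoulli_sum_poly_nonneg p poly_bernoulli_sum_poly_1)
    also have "iexp (- (?u n * \<mu> n)) = (\<Prod>k<n. iexp (- (?u n * p k)))"
      unfolding exp_sum[OF finite_lessThan, symmetric] \<mu>_def
      by (simp add: sum_distrib_left sum_negf)
    finally show ?thesis
      by (simp add: bernoulli_sum_poly_def map_poly_of_real_prod poly_prod map_poly_pCons
          bernoulli_char_def prod.distrib mult.commute)
  qed
  have bound: "\<forall>\<^sub>F n in sequentially.
      norm (char (?M n) t - of_real (exp (- (t\<^sup>2) / 2))) \<le> \<bar>t\<bar> ^ 3 / sqrt (V n) + t ^ 4 / V n"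
    using filterlim_at_top_dense[THEN iffD1, OF V, rule_format, of 0]
  proof eventually_elim
    case (elim n)
    \<comment> \<open>The Gaussian is split into factors carrying the individual variances, to be
      compared factor by factor.\<close>
    let ?w = "\<lambda>k. exp (- ((?u n)\<^sup>2 * (p k * (1 - p k)) / 2))"
    have "(\<Sum>k<n. - ((?u n)\<^sup>2 * (p k * (1 - p k)) / 2)) = - ((?u n)\<^sup>2 * V n / 2)"
      unfolding V_def by (simp add: sum_distrib_left sum_divide_distrib sum_negf)
    also have "\<dots> = - (t\<^sup>2) / 2"
      using elim by (simp add: power_divide)
    finally have w: "(\<Prod>k<n. ?w k) = exp (- (t\<^sup>2) / 2)"
      by (simp add: exp_sum[symmetric])
    have "norm (char (?M n) t - of_real (exp (- (t\<^sup>2) / 2)))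
        = norm ((\<Prod>k<n. bernoulli_char (p k) (?u n)) - (\<Prod>k<n. complex_of_real (?w k)))"
      unfolding char_eq w[symmetric] of_real_prod ..
    \<comment> \<open>All factors have norm at most 1, so the difference of the products is bounded
      by the sum of the differences.\<close>
    also have "\<dots> \<le> (\<Sum>k<n. norm (bernoulli_char (p k) (?u n) - of_real (?w k)))"
      by (intro norm_prod_diff norm_bernoulli_char_le_1 p) (use p in auto)
    also have "\<dots> \<le> (\<Sum>k<n. p k * (1 - p k) * (\<bar>?u n\<bar> ^ 3 + ?u n ^ 4))"
      by (intro sum_mono bernoulli_char_approx p)
    also have "\<dots> = V n * (\<bar>?u n\<bar> ^ 3 + ?u n ^ 4)"
      unfolding V_def by (rule sum_distrib_right[symmetric])
    also have "\<dots> = \<bar>t\<bar> ^ 3 / sqrt (V n) + t ^ 4 / V n"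
    proof -
      have "0 < sqrt (V n)" "V n = sqrt (V n) * sqrt (V n)" using elim by simp_all
      then show ?thesis
        by (simp add: power_divide field_simps power3_eq_cube power4_eq_xxxx)
    qed
    finally show ?case .
  qed
  have "(\<lambda>n. \<bar>t\<bar> ^ 3 / sqrt (V n) + t ^ 4 / V n) \<longlonglongrightarrow> 0 + 0"
    by (intro tendsto_add tendsto_divide_0[OF tendsto_const] filterlim_at_top_imp_at_infinity V
        filterlim_compose[OF sqrt_at_top V])
  then have "(\<lambda>n. char (?M n) t - of_real (exp (- (t\<^sup>2) / 2))) \<longlonglongrightarrow> 0"
    using bound by (intro Lim_null_comparison[OF bound]) simp
  then show "(\<lambda>n. char (?M n) t) \<longlonglongrightarrow> char std_normal_distribution t"
    by (simp add: char_std_normal_distribution LIM_zero_iff)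
qed (rule real_dist_normal_dist prob_space.real_distribution_distr[OF prob_space_measure_pmf] | simp)+

section \<open>Factorisation of the polynomials \<open>Ph s n\<close>\<close>

text \<open>By the recursion the next polynomial is \<open>x / (n+1)^s\<close> times the partial sum
  so far, so adding it multiplies that sum by \<open>1 + x / (n+1)^s\<close>.\<close>

lemma sum_Ph: "(\<Sum>k\<in>{0..n}. Ph s k) = (\<Prod>k=1..n. [:1, 1 / real k powr s:])"
proof (induction n)
  case (Suc n)
  have "(\<Sum>k\<in>{0..Suc n}. Ph s k) = (\<Sum>k\<in>{0..n}. Ph s k) * [:1, 1 / real (Suc n) powr s:]"
    by (simp add: algebra_simps)
  then show ?case
    using Suc by (simp add: prod.nat_ivl_Suc')
qed simp

text \<open>As \<open>0 powr s = 0\<close> even for \<open>s = 0\<close>, the factor with index 0 is the monomial \<open>x\<close>.\<close>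

lemma Ph_eq_bernoulli_sum_poly:
  "\<exists>c>0. Ph s n = smult c (bernoulli_sum_poly (\<lambda>k. 1 / (1 + real k powr s)) n)"
proof (cases n)
  case 0
  then show ?thesis by (auto simp: bernoulli_sum_poly_def intro!: exI[of _ 1])
next
  case (Suc m)
  let ?p = "\<lambda>k::nat. 1 / (1 + real k powr s)"
  \<comment> \<open>The value of \<open>1 + x / k^s\<close> at \<open>x = 1\<close>; dividing by it
    leaves a Bernoulli generating function.\<close>
  let ?w = "\<lambda>k::nat. 1 + 1 / real k powr s"
  have factor: "[:1, 1 / real k powr s:] = smult (?w k) [:1 - ?p k, ?p k:]" if "k \<ge> 1" for k
  proof -
    have *: "(1 + 1 / y) * (1 - 1 / (1 + y)) = 1" "(1 + 1 / y) * (1 / (1 + y)) = 1 / y" if "0 < y" for y :: real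
      using that by (simp_all add: divide_simps)
    have "0 < real k powr s" using that by simp
    from *[OF this]
    show ?thesis by (simp only: smult_pCons smult_0_right)
  qed
  have "Ph s n = smult (1 / real n powr s) ([:0, 1:] * (\<Prod>k=1..m. smult (?w k) [:1 - ?p k, ?p k:]))"
  proof -
    have "(\<Prod>k=1..m. [:1, 1 / real k powr s:]) = (\<Prod>k=1..m. smult (?w k) [:1 - ?p k, ?p k:])"
      by (intro prod.cong factor) auto
    then show ?thesis by (simp only: Suc Ph.simps sum_Ph)
  qed
  also have "\<dots> = smult (1 / real n powr s * (\<Prod>k=1..m. ?w k)) ([:0, 1:] * (\<Prod>k=1..m. [:1 - ?p k, ?p k:]))"
    by (simp only: prod_smult mult_smult_right smult_smult)
  also have "[:0, 1:] * (\<Prod>k=1..m. [:1 - ?p k, ?p k:]) = bernoulli_sum_poly ?p n"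
    unfolding bernoulli_sum_poly_def Suc prod.lessThan_Suc_shift
    by (simp add: prod.atLeast_Suc_atMost_Suc_shift prod.atLeast1_atMost_eq)
  finally have "Ph s n = smult (1 / real n powr s * (\<Prod>k=1..m. ?w k)) (bernoulli_sum_poly ?p n)" .
  moreover have "0 < 1 / real n powr s * (\<Prod>k=1..m. ?w k)"
    using Suc by (intro mult_pos_pos prod_pos) (auto intro: add_pos_nonneg)
  ultimately show ?thesis by blast
qed

section \<open>Divergence of the variance\<close>

text \<open>With \<open>x = k^s\<close> the variance is \<open>x / (1 + x)^2\<close>. From
  \<open>s \<ge> 0\<close> follows \<open>x \<ge> 1\<close>, so this is at least
  \<open>1 / (4 * x)\<close>; from \<open>s \<le> 1\<close> follows
  \<open>x \<le> k\<close>.\<close>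

lemma variance_ge_harmonic:
  assumes "0 \<le> s" "s \<le> 1" "k \<ge> 1"
  shows "inverse (real k) / 4 \<le> 1 / (1 + real k powr s) * (1 - 1 / (1 + real k powr s))"
proof -
  define x where "x = real k powr s"
  have x: "1 \<le> x" using assms by (simp add: x_def ge_one_powr_ge_zero)
  have "x \<le> real k powr 1" unfolding x_def using assms by (intro powr_mono) auto
  then have "inverse (real k) / 4 \<le> inverse x / 4" using assms x by (simp add: le_imp_inverse_le)
  also have "\<dots> = x / (2 * x)\<^sup>2" using x by (simp add: power2_eq_square field_simps)
  also have "\<dots> \<le> x / (1 + x)\<^sup>2" using x by (intro divide_left_mono power_mono mult_pos_pos) auto
  also have "\<dots> = 1 / (1 + x) * (1 - 1 / (1 + x))" using x by (simp add: power2_eq_square field_simps)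
  finally show ?thesis unfolding x_def .
qed

lemma variance_at_top:
  assumes s: "0 \<le> s" "s \<le> 1"
  shows "filterlim (\<lambda>n. \<Sum>k<n. 1 / (1 + real k powr s) * (1 - 1 / (1 + real k powr s))) at_top sequentially"
    (is "filterlim (\<lambda>n. \<Sum>k<n. ?v k) _ _")
proof -
  have "filterlim (\<lambda>n. harm n / 4 :: real) at_top sequentially"
    using filterlim_tendsto_pos_mult_at_top[OF tendsto_const[of "1 / 4 :: real"] _ harm_at_top] by simp
  \<comment> \<open>The bound covers indices 1 to \<open>n\<close>, hence the range below
    \<open>Suc n\<close>; index 0 has variance 0.\<close>
  moreover have "harm n / 4 \<le> (\<Sum>k<Suc n. ?v k)" for n
  proof -
    have "harm n / 4 \<le> (\<Sum>k=1..n. ?v k)"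
      unfolding harm_def sum_divide_distrib by (intro sum_mono variance_ge_harmonic s) auto
    also have "\<dots> \<le> (\<Sum>k<Suc n. ?v k)"
      by (intro sum_mono2) (auto simp: divide_le_eq add_pos_nonneg)
    finally show ?thesis .
  qed
  ultimately have "filterlim (\<lambda>n. \<Sum>k<Suc n. ?v k) at_top sequentially"
    by (rule filterlim_at_top_mono[OF _ always_eventually[OF allI]])
  then show ?thesis by (rule filterlim_sequentially_Suc[THEN iffD1])
qed

section \<open>Asymptotic normality of the coefficients\<close>

theorem theorem1:
  fixes s :: real
  assumes "s \<in> {0..1}"
  shows "\<exists>a b :: nat \<Rightarrow> real.
    (\<forall>\<^sub>F n in sequentially. b n > 0) \<and>
    (\<lambda>n. SUP x::real.
        \<bar>1 / poly (Ph s n) 1 * (\<Sum>k | k \<le> n \<and> real k \<le> a n + x * b n. Acoef n k s)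
          - 1 / sqrt (2 * pi) * (LBINT t:{..x}. exp (- t\<^sup>2 / 2))\<bar>) \<longlonglongrightarrow> 0"
proof -
  define p where "p k = 1 / (1 + real k powr s)" for k
  have p: "0 \<le> p k" "p k \<le> 1" for k by (auto simp: p_def divide_le_eq add_pos_nonneg)
  define a where "a n = (\<Sum>k<n. p k)" for n
  define V where "V n = (\<Sum>k<n. p k * (1 - p k))" for n
  define b where "b n = sqrt (V n)" for n
  define M where "M n = distr (poly_pmf (bernoulli_sum_poly p n)) borel (\<lambda>k. (real k - a n) / b n)" for n
  have V: "filterlim V at_top sequentially"
    unfolding V_def p_def using assms by (intro variance_at_top) auto
  then have "\<forall>\<^sub>F n in sequentially. 0 < V n"
    by (simp add: filterlim_at_top_dense)
  then have b: "\<forall>\<^sub>F n in sequentially. 0 < b n"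
    by (simp add: b_def)
  have "weak_conv_m M std_normal_distribution"
    using bernoulli_sum_central_limit[of p, folded V_def a_def, OF p V]
    unfolding M_def b_def .
  moreover have "real_distribution (M n)" for n
    unfolding M_def by (intro prob_space.real_distribution_distr[OF prob_space_measure_pmf]) simp
  ultimately have lim: "(\<lambda>n. SUP x. \<bar>cdf (M n) x - cdf std_normal_distribution x\<bar>) \<longlonglongrightarrow> 0"
    by (intro Polya_uniform_cdf_convergence real_dist_normal_dist continuous_on_cdf_std_normal_distribution)
  have cdf_eq: "1 / poly (Ph s n) 1 * (\<Sum>k | k \<le> n \<and> real k \<le> a n + x * b n. Acoef n k s) = cdf (M n) x"
    if "0 < b n" for n x
  proof -
    \<comment> \<open>As the Bernoulli polynomial is 1 at 1, \<open>c\<close> equals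
      \<open>poly (Ph s n) 1\<close> and cancels.\<close>
    obtain c where c: "c > 0" "Ph s n = smult c (bernoulli_sum_poly p n)"
      using Ph_eq_bernoulli_sum_poly[of s n] unfolding p_def by blast
    have "cdf (M n) x = (\<Sum>k | k \<le> n \<and> real k \<le> a n + x * b n. coeff (bernoulli_sum_poly p n) k)"
      unfolding M_def
      by (intro cdf_distr_poly_pmf coeff_bernoulli_sum_poly_nonneg p poly_bernoulli_sum_poly_1
          degree_bernoulli_sum_poly_le that)
    then show ?thesis
      using c by (simp add: Acoef_def poly_bernoulli_sum_poly_1 sum_distrib_left[symmetric])
  qed
  \<comment> \<open>The identity with \<open>cdf (M n)\<close> is available once
    \<open>b n > 0\<close>, hence for all large \<open>n\<close>, which is enough for the
    limit.\<close>
  have "(\<lambda>n. SUP x::real.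
        \<bar>1 / poly (Ph s n) 1 * (\<Sum>k | k \<le> n \<and> real k \<le> a n + x * b n. Acoef n k s)
          - 1 / sqrt (2 * pi) * (LBINT t:{..x}. exp (- t\<^sup>2 / 2))\<bar>) \<longlonglongrightarrow> 0"
    by (rule Lim_transform_eventually[OF lim], use b in eventually_elim)
       (simp only: cdf_eq cdf_std_normal_distribution)
  with b show ?thesis by blast
qed

end
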